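(* For every additively idempotent semiring $\mathbb{S}$ and every $n\ge 2$, the monoid $U^0T_n(\mathbb{S})$ is equationally equivalent to the monoid $T_n(\mathbb{B})$ of all $n\times n$ triangular Boolean matrices.
   Context: A semiring here is $\mathbb{S}=(S,+,\cdot)$ such that: (S1) $(S,+)$ is a commutative semigroup; (S2) $(S,\cdot)$ is a semigroup; (S3) both distributive laws hold; (S4) there is an element $0$ with $0+a=a+0=a$ and $a\cdot 0=0\cdot a=0$ for all $a\in S$; (S5) there is an element $1\neq 0$ with $a\cdot 1=1\cdot a=a$ for all $a\in S$. (Multiplication need not be commutative.) It is additively idempotent if $a+a=a$ for all $a\in S$. $\mathbb{B}=(\{0,1\},+,\cdot)$ is the Boolean semiring, in which $1+1=1$. An $n\times n$ matrix $(\alpha_{ij})$ over $\mathbb{S}$ is triangular if $\alpha_{ij}=0$ whenever $j<i$. $T_n(\mathbb{S})$ is the monoid of all $n\times n$ triangular matrices over $\mathbb{S}$ under matrix multiplication, and $U^0T_n(\mathbb{S})$ is its submonoid of matrices all of whose diagonal entries lie in $\{0,1\}$. Monoids are considered as semigroups (only binary multiplication in the signature). A semigroup identity is a pair $\mathbf{u}\approx\mathbf{v}$ of words in the free semigroup $\mathcal{X}^+$ on a countably infinite set $\mathcal{X}$; it holds in a semigroup $S$ if $\varphi(\mathbf{u})=\varphi(\mathbf{v})$ for every morphism $\varphi:\mathcal{X}^+\to S$. Two semigroups are equationally equivalent if they satisfy the same semigroup identities. *)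

theory Defs
  imports "HOL-Algebra.Group" "Jordan_Normal_Form.Matrix"
begin

text \<open>The free semigroup over the countably infinite alphabet of natural numbers.  It has no
  neutral element; the field \<open>one\<close> of the record is a dummy that lies outside the carrier and is
  not used by \<^const>\<open>hom\<close>.\<close>

definition free_semigroup :: "nat list monoid" where
  "free_semigroup = \<lparr>carrier = {w. w \<noteq> []}, mult = (@), one = []\<rparr>"

text \<open>Monoids are viewed as semigroups here: \<^const>\<open>hom\<close> only involves carriers and
  multiplications, so neutral elements play no role in satisfaction of identities.\<close>

definition satisfies_identity :: "('a, 'm) monoid_scheme \<Rightarrow> nat list \<Rightarrow> nat list \<Rightarrow> bool" where
  "satisfies_identity G u v \<longleftrightarrow> (\<forall>\<phi> \<in> hom free_semigroup G. \<phi> u = \<phi> v)"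

definition equationally_equivalent ::
  "('a, 'm) monoid_scheme \<Rightarrow> ('b, 'k) monoid_scheme \<Rightarrow> bool" where
  "equationally_equivalent G H \<longleftrightarrow>
     (\<forall>u \<in> carrier free_semigroup. \<forall>v \<in> carrier free_semigroup.
        satisfies_identity G u v \<longleftrightarrow> satisfies_identity H u v)"

datatype boolean = BZero | BOne

instantiation boolean :: semiring_1
begin

definition zero_boolean :: boolean where "0 = BZero"

definition one_boolean :: boolean where "1 = BOne"

definition plus_boolean :: "boolean \<Rightarrow> boolean \<Rightarrow> boolean" where
  "a + b = (if a = BZero then b else BOne)"

definition times_boolean :: "boolean \<Rightarrow> boolean \<Rightarrow> boolean" where
  "a * b = (if a = BZero then BZero else b)"

instance
proof
  fix a b c :: boolean
  show "a + b + c = a + (b + c)" "0 + a = a"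
    "a * b * c = a * (b * c)" "1 * a = a" "0 * a = 0"
    "(0::boolean) \<noteq> 1"
    by (auto simp: zero_boolean_def one_boolean_def plus_boolean_def times_boolean_def)
  show "a + b = b + a" "(a + b) * c = a * c + b * c" "a * (b + c) = a * b + a * c"
    "a * 1 = a" "a * 0 = 0"
    by (cases a; cases b; cases c;
        simp add: zero_boolean_def one_boolean_def plus_boolean_def times_boolean_def)+
qed

end

text \<open>The class \<open>semiring_1\<close> is exactly the notion of semiring used here: multiplication need not
  commute and \<open>0 \<noteq> 1\<close>.  Note that \<^const>\<open>upper_triangular\<close> requires the entries strictly below
  the diagonal to vanish.\<close>

definition triangular_monoid :: "nat \<Rightarrow> 'a :: semiring_1 mat monoid" where
  "triangular_monoid n =
     \<lparr>carrier = {A \<in> carrier_mat n n. upper_triangular A}, mult = (*), one = 1\<^sub>m n\<rparr>"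

definition triangular01_monoid :: "nat \<Rightarrow> 'a :: semiring_1 mat monoid" where
  "triangular01_monoid n =
     (triangular_monoid n)
       \<lparr>carrier := {A \<in> carrier (triangular_monoid n). \<forall>i<n. A $$ (i, i) \<in> {0, 1}}\<rparr>"

lemma triangular_mult_diag:
  fixes A B :: "'a :: semiring_1 mat"
  assumes "A \<in> carrier (triangular_monoid n)" "B \<in> carrier (triangular_monoid n)" "i < n"
  shows "(A * B) $$ (i, i) = A $$ (i, i) * B $$ (i, i)"
proof -
  have "(A * B) $$ (i, i) = (\<Sum>k = 0..<n. A $$ (i, k) * B $$ (k, i))"
    using assms by (auto simp: triangular_monoid_def scalar_prod_def)
  also have "\<dots> = (\<Sum>k = 0..<n. if k = i then A $$ (i, i) * B $$ (i, i) else 0)"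
  proof (rule sum.cong[OF refl])
    fix k assume "k \<in> {0..<n}"
    then show "A $$ (i, k) * B $$ (k, i) = (if k = i then A $$ (i, i) * B $$ (i, i) else 0)"
      using assms by (cases k i rule: linorder_cases)
        (auto simp: triangular_monoid_def upper_triangular_def)
  qed
  finally show ?thesis using assms(3) by simp
qed

lemma triangular_mult_closed:
  fixes A B :: "'a :: semiring_1 mat"
  assumes "A \<in> carrier (triangular_monoid n)" "B \<in> carrier (triangular_monoid n)"
  shows "A * B \<in> carrier (triangular_monoid n)"
proof -
  have "(A * B) $$ (i, j) = 0" if "i < n" "j < i" for i j
  proof -
    have "(A * B) $$ (i, j) = (\<Sum>k = 0..<n. A $$ (i, k) * B $$ (k, j))"
      using assms that by (auto simp: triangular_monoid_def scalar_prod_def)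
    also have "\<dots> = 0"
    proof (rule sum.neutral, rule ballI)
      fix k assume "k \<in> {0..<n}"
      then show "A $$ (i, k) * B $$ (k, j) = 0"
        using assms that by (cases "k < i") (auto simp: triangular_monoid_def upper_triangular_def)
    qed
    finally show ?thesis .
  qed
  then show ?thesis
    using assms by (auto simp: triangular_monoid_def upper_triangular_def)
qed

lemma monoid_triangular: "monoid (triangular_monoid n :: 'a :: semiring_1 mat monoid)"
proof (rule monoidI)
  fix A B :: "'a mat"
  assume "A \<in> carrier (triangular_monoid n)" "B \<in> carrier (triangular_monoid n)"
  from triangular_mult_closed[OF this]
  show "A \<otimes>\<^bsub>triangular_monoid n\<^esub> B \<in> carrier (triangular_monoid n)"
    by (simp add: triangular_monoid_def)
qed (auto simp: triangular_monoid_def upper_triangular_def)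

lemma submonoid_triangular01:
  "submonoid (carrier (triangular01_monoid n)) (triangular_monoid n :: 'a :: semiring_1 mat monoid)"
proof
  fix A B :: "'a mat"
  assume A: "A \<in> carrier (triangular01_monoid n)" and B: "B \<in> carrier (triangular01_monoid n)"
  then have T: "A \<in> carrier (triangular_monoid n)" "B \<in> carrier (triangular_monoid n)"
    by (auto simp: triangular01_monoid_def)
  have "(A * B) $$ (i, i) \<in> {0, 1}" if "i < n" for i
  proof -
    have "A $$ (i, i) = 0 \<or> A $$ (i, i) = 1" "B $$ (i, i) = 0 \<or> B $$ (i, i) = 1"
      using A B that by (auto simp: triangular01_monoid_def)
    then show ?thesis
      unfolding triangular_mult_diag[OF T that] by auto
  qed
  with triangular_mult_closed[OF T]
  have "A * B \<in> carrier (triangular01_monoid n)"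
    by (auto simp: triangular01_monoid_def)
  then show "A \<otimes>\<^bsub>triangular_monoid n\<^esub> B \<in> carrier (triangular01_monoid n)"
    by (simp add: triangular_monoid_def)
qed (auto simp: triangular01_monoid_def triangular_monoid_def upper_triangular_def)

end

theory Submission
  imports Defs
begin

text \<open>An entry of a product of triangular matrices with diagonal in \<open>{0, 1}\<close> is a sum over
  factorizations \<open>u\<^sub>0 y\<^sub>1 u\<^sub>1 \<dots> y\<^sub>k u\<^sub>k\<close> of the word, where the \<open>y\<^sub>t\<close> mark the strict ascents of a
  path through the index set and every \<open>u\<^sub>t\<close> only uses letters whose matrix has a 1 at the current
  diagonal position.  The summand depends on the path and on \<open>y\<^sub>1, \<dots>, y\<^sub>k\<close> alone, so over an
  additively idempotent semiring only the existence of such factorizations matters.  Hence an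
  identity holds iff both sides lie in the same languages
  \<open>A\<^sub>0\<^sup>* y\<^sub>1 A\<^sub>1\<^sup>* \<dots> y\<^sub>k A\<^sub>k\<^sup>*\<close> with \<open>k < n\<close>; this does not mention the semiring.\<close>

section \<open>Identities as equations between values of words\<close>

text \<open>Folding from the unit gives the empty word a value, so inductions can start there
  although it lies outside the free semigroup.\<close>

definition word_value :: "('a, 'm) monoid_scheme \<Rightarrow> (nat \<Rightarrow> 'a) \<Rightarrow> nat list \<Rightarrow> 'a" where
  "word_value G f u = foldr (\<lambda>x a. f x \<otimes>\<^bsub>G\<^esub> a) u \<one>\<^bsub>G\<^esub>"

lemma word_value_Nil [simp]: "word_value G f [] = \<one>\<^bsub>G\<^esub>"
  and word_value_Cons [simp]: "word_value G f (x # u) = f x \<otimes>\<^bsub>G\<^esub> word_value G f u"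
  by (simp_all add: word_value_def)

context monoid
begin

lemma word_value_closed: "range f \<subseteq> carrier G \<Longrightarrow> word_value G f u \<in> carrier G"
  by (induction u) auto

lemma word_value_append:
  "range f \<subseteq> carrier G \<Longrightarrow> word_value G f (u @ v) = word_value G f u \<otimes> word_value G f v"
  by (induction u) (auto simp: word_value_closed m_assoc image_subset_iff)

lemma hom_eq_word_value:
  assumes \<phi>: "\<phi> \<in> hom free_semigroup G" and "u \<noteq> []"
  shows "\<phi> u = word_value G (\<lambda>x. \<phi> [x]) u"
  using \<open>u \<noteq> []\<close>
proof (induction u rule: list_nonempty_induct)
  case (single x)
  have "\<phi> [x] \<in> carrier G"
    using \<phi> by (auto simp: hom_def free_semigroup_def)
  then show ?case by simp
next
  case (cons x u)
  have "\<phi> ([x] @ u) = \<phi> [x] \<otimes> \<phi> u"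
    using hom_mult[OF \<phi>, of "[x]" u] cons.hyps by (simp add: free_semigroup_def)
  then show ?case using cons.IH by simp
qed

text \<open>Homomorphisms from the free semigroup correspond to free choices of images for the
  letters. Nonemptiness matters because \<open>hom\<close> does not constrain the value at
  \<open>[]\<close>.\<close>

lemma satisfies_identity_iff:
  assumes "u \<noteq> []" "v \<noteq> []"
  shows "satisfies_identity G u v \<longleftrightarrow>
    (\<forall>f. range f \<subseteq> carrier G \<longrightarrow> word_value G f u = word_value G f v)"
proof
  assume id: "satisfies_identity G u v"
  show "\<forall>f. range f \<subseteq> carrier G \<longrightarrow> word_value G f u = word_value G f v"
  proof (intro allI impI)
    fix f :: "nat \<Rightarrow> 'a" assume "range f \<subseteq> carrier G"
    then have "word_value G f \<in> hom free_semigroup G"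
      by (auto simp: hom_def free_semigroup_def word_value_closed word_value_append)
    then show "word_value G f u = word_value G f v"
      using id by (auto simp: satisfies_identity_def)
  qed
next
  assume eq: "\<forall>f. range f \<subseteq> carrier G \<longrightarrow> word_value G f u = word_value G f v"
  show "satisfies_identity G u v"
    unfolding satisfies_identity_def
  proof
    fix \<phi> assume \<phi>: "\<phi> \<in> hom free_semigroup G"
    then have "range (\<lambda>x. \<phi> [x]) \<subseteq> carrier G"
      by (auto simp: hom_def free_semigroup_def)
    then show "\<phi> u = \<phi> v"
      using eq hom_eq_word_value[OF \<phi> assms(1)] hom_eq_word_value[OF \<phi> assms(2)] by metis
  qed
qed

end

section \<open>Patterns, routes and their weights\<close>

text \<open>\<open>matches A [(y\<^sub>1, B\<^sub>1), \<dots>, (y\<^sub>k, B\<^sub>k)]\<close> is the language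
  \<open>A\<^sup>* y\<^sub>1 B\<^sub>1\<^sup>* \<dots> y\<^sub>k B\<^sub>k\<^sup>*\<close>.\<close>

fun matches :: "nat set \<Rightarrow> (nat \<times> nat set) list \<Rightarrow> nat list \<Rightarrow> bool" where
  "matches A [] [] \<longleftrightarrow> True"
| "matches A (p # ps) [] \<longleftrightarrow> False"
| "matches A [] (x # u) \<longleftrightarrow> x \<in> A \<and> matches A [] u"
| "matches A ((y, B) # ps) (x # u) \<longleftrightarrow> x \<in> A \<and> matches A ((y, B) # ps) u \<or> x = y \<and> matches B ps u"

text \<open>A route records the strict ascents of a path from \<open>i\<close> to \<open>j\<close> that reads \<open>u\<close>, each as the
  letter read and the index reached; \<open>D i\<close> is the set of letters that may be read while staying
  at \<open>i\<close>.\<close>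

fun routes :: "(nat \<Rightarrow> nat set) \<Rightarrow> nat \<Rightarrow> nat \<Rightarrow> nat list \<Rightarrow> (nat \<times> nat) list set" where
  "routes D i j [] = (if i = j then {[]} else {})"
| "routes D i j (x # u) =
     (if x \<in> D i then routes D i j u else {}) \<union> (\<Union>k\<in>{i<..j}. Cons (x, k) ` routes D k j u)"

fun ascending :: "nat \<Rightarrow> nat \<Rightarrow> (nat \<times> nat) list \<Rightarrow> bool" where
  "ascending i j [] \<longleftrightarrow> i = j"
| "ascending i j ((y, k) # w) \<longleftrightarrow> i < k \<and> k \<le> j \<and> ascending k j w"

lemma ascending_length: "ascending i j w \<Longrightarrow> i + length w \<le> j"
  by (induction i j w rule: ascending.induct) auto

text \<open>The first condition ignores the word, so words matching the same patterns have the same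
  routes.\<close>

lemma mem_routes_iff:
  "w \<in> routes D i j u \<longleftrightarrow> ascending i j w \<and> matches (D i) (map (apsnd D) w) u"
proof (induction u arbitrary: i w)
  case Nil
  then show ?case by (cases w) auto
next
  case (Cons x u)
  show ?case
  proof (cases w)
    case (Cons p w')
    obtain y k where "p = (y, k)" by fastforce
    then show ?thesis
      using Cons by (auto simp: Cons.IH image_iff)
  qed (auto simp: Cons.IH)
qed

lemma finite_routes: "finite (routes D i j u)"
  by (induction u arbitrary: i) auto

lemma routes_eq_empty: "j < i \<Longrightarrow> routes D i j u = {}"
  using ascending_length by (fastforce simp: mem_routes_iff)

text \<open>Letters read while staying at an index contribute a diagonal 1, so only the ascents
  leave a factor.\<close>

fun weight :: "(nat \<Rightarrow> 'a :: semiring_1 mat) \<Rightarrow> nat \<Rightarrow> (nat \<times> nat) list \<Rightarrow> 'a" where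
  "weight f i [] = 1"
| "weight f i ((y, k) # w) = f y $$ (i, k) * weight f k w"

text \<open>The right side counts the intersection twice; idempotence absorbs the second
  copy.\<close>

lemma sum_Un_idem:
  fixes f :: "'b \<Rightarrow> 'a :: semiring_1"
  assumes idem: "\<And>a :: 'a. a + a = a" and "finite A" "finite B"
  shows "sum f (A \<union> B) = sum f A + sum f B"
proof -
  have "sum f (A - B) + sum f (A \<inter> B) = sum f A"
    using \<open>finite A\<close> sum.Int_Diff[of A f B] by (simp add: add.commute)
  then have "sum f A + sum f (A \<inter> B) = sum f A"
    by (metis add.assoc idem)
  moreover have "sum f B = sum f (A \<inter> B) + sum f (B - A)"
    using \<open>finite B\<close> sum.Int_Diff[of B f A] by (simp add: Int_commute)
  moreover have "sum f (A \<union> B) = sum f A + sum f (B - A)"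
    using assms(2,3) sum.union_disjoint[of A "B - A" f] by simp
  ultimately show ?thesis
    by (simp add: add.assoc[symmetric])
qed

section \<open>Matrix entries as sums over routes\<close>

lemma triangular01_simps [simp]:
  "mult (triangular01_monoid n) = (*)" "one (triangular01_monoid n) = 1\<^sub>m n"
  by (simp_all add: triangular01_monoid_def triangular_monoid_def)

lemma triangular01_carrier_iff:
  "A \<in> carrier (triangular01_monoid n) \<longleftrightarrow>
     A \<in> carrier_mat n n \<and> (\<forall>i<n. \<forall>j<i. A $$ (i, j) = 0) \<and> (\<forall>i<n. A $$ (i, i) \<in> {0, 1})"
  by (auto simp: triangular01_monoid_def triangular_monoid_def upper_triangular_def)

lemma monoid_triangular01: "monoid (triangular01_monoid n :: 'a :: semiring_1 mat monoid)"
  using submonoid.submonoid_is_monoid[OF submonoid_triangular01 monoid_triangular]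
  by (simp add: triangular01_monoid_def)

lemma word_value_carrier_mat:
  fixes f :: "nat \<Rightarrow> 'a :: semiring_1 mat"
  assumes "range f \<subseteq> carrier (triangular01_monoid n)"
  shows "word_value (triangular01_monoid n) f u \<in> carrier_mat n n"
  using monoid.word_value_closed[OF monoid_triangular01 assms]
  by (simp add: triangular01_carrier_iff)

lemma word_value_Cons_entry:
  fixes f :: "nat \<Rightarrow> 'a :: semiring_1 mat"
  assumes f: "range f \<subseteq> carrier (triangular01_monoid n)" and "i < n" "j < n"
  shows "word_value (triangular01_monoid n) f (x # u) $$ (i, j) =
    (\<Sum>k = 0..<n. f x $$ (i, k) * word_value (triangular01_monoid n) f u $$ (k, j))"
proof -
  have "f x \<in> carrier_mat n n"
    using f by (auto simp: triangular01_carrier_iff image_subset_iff)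
  then show ?thesis
    using assms(2,3) word_value_carrier_mat[OF f, of u] by (auto simp: scalar_prod_def)
qed

lemma word_value_entry:
  fixes f :: "nat \<Rightarrow> 'a :: semiring_1 mat"
  assumes idem: "\<And>a :: 'a. a + a = a"
    and f: "range f \<subseteq> carrier (triangular01_monoid n)"
    and "i < n" "j < n"
  shows "word_value (triangular01_monoid n) f u $$ (i, j) =
    sum (weight f i) (routes (\<lambda>i. {x. f x $$ (i, i) = 1}) i j u)"
  using \<open>i < n\<close>
proof (induction u arbitrary: i)
  case Nil
  then show ?case using \<open>j < n\<close> by simp
next
  case (Cons x u)
  define D where "D = (\<lambda>i. {x. f x $$ (i, i) = 1})"
  define M where "M = word_value (triangular01_monoid n) f u"
  have IH: "M $$ (k, j) = sum (weight f k) (routes D k j u)" if "k < n" for k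
    using Cons.IH[OF that] by (simp add: M_def D_def)
  have fx: "f x \<in> carrier (triangular01_monoid n)"
    using f by auto
  \<comment> \<open>A diagonal 0 excludes staying and a diagonal 1 leaves the weights unchanged;
    here the restriction to 0 and 1 enters.\<close>
  have stay: "f x $$ (i, i) * M $$ (i, j) = sum (weight f i) (if x \<in> D i then routes D i j u else {})"
    using fx \<open>i < n\<close> IH[of i] by (auto simp: triangular01_carrier_iff D_def)
  have ascend: "f x $$ (i, k) * M $$ (k, j) = sum (weight f i) (Cons (x, k) ` routes D k j u)"
    if "k \<in> {i<..j}" for k
    using that \<open>j < n\<close> IH[of k] by (simp add: sum.reindex sum_distrib_left)
  have "word_value (triangular01_monoid n) f (x # u) $$ (i, j) =
      (\<Sum>k = 0..<n. f x $$ (i, k) * M $$ (k, j))"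
    using word_value_Cons_entry[OF f \<open>i < n\<close> \<open>j < n\<close>] by (simp add: M_def)
  also have "\<dots> = (\<Sum>k\<in>insert i {i<..j}. f x $$ (i, k) * M $$ (k, j))"
  proof (rule sum.mono_neutral_right)
    show "insert i {i<..j} \<subseteq> {0..<n}"
      using \<open>i < n\<close> \<open>j < n\<close> by auto
    show "\<forall>k\<in>{0..<n} - insert i {i<..j}. f x $$ (i, k) * M $$ (k, j) = 0"
    proof
      fix k assume "k \<in> {0..<n} - insert i {i<..j}"
      then consider "k < n" "k < i" | "k < n" "j < k" by force
      then show "f x $$ (i, k) * M $$ (k, j) = 0"
        by cases (use fx \<open>i < n\<close> IH[of k] in
          \<open>auto simp: triangular01_carrier_iff routes_eq_empty\<close>)
    qed
  qed simp
  also have "\<dots> = f x $$ (i, i) * M $$ (i, j) + (\<Sum>k\<in>{i<..j}. f x $$ (i, k) * M $$ (k, j))"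
    by simp
  also have "(\<Sum>k\<in>{i<..j}. f x $$ (i, k) * M $$ (k, j)) =
      (\<Sum>k\<in>{i<..j}. sum (weight f i) (Cons (x, k) ` routes D k j u))"
    by (rule sum.cong[OF refl ascend])
  also have "\<dots> = sum (weight f i) (\<Union>k\<in>{i<..j}. Cons (x, k) ` routes D k j u)"
    by (rule sum.UNION_disjoint[symmetric]) (auto simp: finite_routes)
  \<comment> \<open>The two sets can overlap: a route ascending at this \<open>x\<close> may also
    arise by staying here and ascending at a later \<open>x\<close>. Hence the need for
    idempotence.\<close>
  also have "f x $$ (i, i) * M $$ (i, j) + \<dots> = sum (weight f i) (routes D i j (x # u))"
    unfolding stay routes.simps by (rule sum_Un_idem[OF idem, symmetric]) (auto simp: finite_routes)
  finally show ?case by (simp only: D_def)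
qed

section \<open>Matrices that recognize a given pattern\<close>

text \<open>Transition matrices of an automaton with states 0 to \<open>length ps\<close>: state
  \<open>a\<close> loops on its letter set and moves to \<open>Suc a\<close> on the letter of
  \<open>ps ! a\<close>.\<close>

definition pattern_mat ::
  "nat \<Rightarrow> nat set \<Rightarrow> (nat \<times> nat set) list \<Rightarrow> nat \<Rightarrow> 'a :: semiring_1 mat" where
  "pattern_mat n A ps x = mat n n (\<lambda>(a, b).
     if b = a then of_bool (a \<le> length ps \<and> x \<in> (A # map snd ps) ! a)
     else of_bool (b = Suc a \<and> a < length ps \<and> x = fst (ps ! a)))"

lemma range_pattern_mat:
  "range (pattern_mat n A ps) \<subseteq> carrier (triangular01_monoid n :: 'a :: semiring_1 mat monoid)"
  by (auto simp: triangular01_carrier_iff pattern_mat_def)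

text \<open>The entry counts accepting runs from \<open>a\<close>, and idempotence truncates the
  count to 0 or 1. The start state is arbitrary so that the induction can advance it.\<close>

lemma word_value_pattern_mat:
  assumes idem: "\<And>a :: 'a :: semiring_1. a + a = a"
    and "length ps < n" "a \<le> length ps"
  shows "word_value (triangular01_monoid n) (pattern_mat n A ps :: _ \<Rightarrow> 'a mat) u $$ (a, length ps) =
    of_bool (matches ((A # map snd ps) ! a) (drop a ps) u)"
  using \<open>a \<le> length ps\<close>
proof (induction u arbitrary: a)
  case Nil
  show ?case
  proof (cases "a = length ps")
    case False
    then obtain p qs where "drop a ps = p # qs"
      using Nil by (metis Cons_nth_drop_Suc le_neq_implies_less)
    then show ?thesis using Nil False \<open>length ps < n\<close> by simp
  qed (use \<open>length ps < n\<close> in simp)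
next
  case (Cons x u)
  define l where "l = length ps"
  define F where "F = (pattern_mat n A ps :: _ \<Rightarrow> 'a mat)"
  define M where "M = word_value (triangular01_monoid n) F u"
  have IH: "M $$ (b, l) = of_bool (matches ((A # map snd ps) ! b) (drop b ps) u)" if "b \<le> l" for b
    using Cons.IH that by (simp add: M_def F_def l_def)
  have l: "l < n" and a: "a \<le> l"
    using Cons.prems \<open>length ps < n\<close> by (simp_all add: l_def)
  have "word_value (triangular01_monoid n) F (x # u) $$ (a, l) =
      (\<Sum>k = 0..<n. F x $$ (a, k) * M $$ (k, l))"
    using word_value_Cons_entry[OF range_pattern_mat, of a n l A ps x u] l a
    by (simp add: F_def M_def)
  \<comment> \<open>The comprehension is empty at the last state, which may loop but has no
    successor.\<close>
  also have "\<dots> = (\<Sum>k\<in>insert a {k. k = Suc a \<and> a < l}. F x $$ (a, k) * M $$ (k, l))"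
    by (rule sum.mono_neutral_right) (use l a in \<open>auto simp: F_def pattern_mat_def l_def\<close>)
  also have "\<dots> = F x $$ (a, a) * M $$ (a, l) +
      (if a < l then F x $$ (a, Suc a) * M $$ (Suc a, l) else 0)"
    by (cases "a < l") simp_all
  also have "\<dots> = of_bool (matches ((A # map snd ps) ! a) (drop a ps) (x # u))"
  proof (cases "a < l")
    case True
    then have "drop a ps = ps ! a # drop (Suc a) ps"
      by (simp add: Cons_nth_drop_Suc l_def)
    moreover obtain y B where "ps ! a = (y, B)"
      by fastforce
    ultimately show ?thesis
      using True l IH[of a] IH[of "Suc a"]
      by (auto simp: F_def pattern_mat_def l_def idem)
  next
    case False
    then show ?thesis
      using a l IH[of a] by (auto simp: F_def pattern_mat_def l_def)
  qed
  finally show ?case by (simp only: F_def l_def)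
qed

section \<open>Criterion for identities and conclusion\<close>

theorem triangular01_satisfies_identity_iff:
  assumes idem: "\<And>a :: 'a :: semiring_1. a + a = a" and "u \<noteq> []" "v \<noteq> []"
  shows "satisfies_identity (triangular01_monoid n :: 'a mat monoid) u v \<longleftrightarrow>
    (\<forall>A ps. length ps < n \<longrightarrow> matches A ps u = matches A ps v)"
  unfolding monoid.satisfies_identity_iff[OF monoid_triangular01 assms(2,3)]
proof (rule iffI; intro allI impI)
  fix A and ps :: "(nat \<times> nat set) list"
  assume id: "\<forall>f :: nat \<Rightarrow> 'a mat. range f \<subseteq> carrier (triangular01_monoid n) \<longrightarrow>
      word_value (triangular01_monoid n) f u = word_value (triangular01_monoid n) f v"
    and len: "length ps < n"
  from id have "word_value (triangular01_monoid n) (pattern_mat n A ps :: _ \<Rightarrow> 'a mat) u =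
      word_value (triangular01_monoid n) (pattern_mat n A ps) v"
    by (simp add: range_pattern_mat)
  then have "(of_bool (matches A ps u) :: 'a) = of_bool (matches A ps v)"
    using word_value_pattern_mat[OF idem len, of 0 A] by (metis drop0 le0 nth_Cons_0)
  \<comment> \<open>Since \<open>0 \<noteq> 1\<close>, \<open>of_bool\<close> is injective.\<close>
  then show "matches A ps u = matches A ps v"
    by (simp split: split_of_bool_asm)
next
  fix f :: "nat \<Rightarrow> 'a mat"
  assume same: "\<forall>A ps. length ps < n \<longrightarrow> matches A ps u = matches A ps v"
    and f: "range f \<subseteq> carrier (triangular01_monoid n)"
  \<comment> \<open>Each ascent raises the index, so a route ending below \<open>n\<close> has fewer
    than \<open>n\<close> ascents and \<open>same\<close> covers its pattern.\<close>
  have routes_eq: "routes D i j u = routes D i j v" if "j < n" for D i j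
  proof -
    have "matches (D i) (map (apsnd D) w) u = matches (D i) (map (apsnd D) w) v"
      if "ascending i j w" for w
      using ascending_length[OF that] \<open>j < n\<close> same by simp
    then show ?thesis by (auto simp: mem_routes_iff)
  qed
  show "word_value (triangular01_monoid n) f u = word_value (triangular01_monoid n) f v"
  proof (rule eq_matI)
    fix i j
    assume "i < dim_row (word_value (triangular01_monoid n) f v)"
      "j < dim_col (word_value (triangular01_monoid n) f v)"
    then have "i < n" "j < n"
      using word_value_carrier_mat[OF f, of v] by auto
    then show "word_value (triangular01_monoid n) f u $$ (i, j) =
        word_value (triangular01_monoid n) f v $$ (i, j)"
      by (simp add: word_value_entry[OF idem f] routes_eq)
  qed (use word_value_carrier_mat[OF f, of u] word_value_carrier_mat[OF f, of v] in auto)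
qed

lemma boolean_idem: "a + a = (a :: boolean)"
  by (cases a) (auto simp: plus_boolean_def)

lemma triangular01_boolean: "triangular01_monoid n = (triangular_monoid n :: boolean mat monoid)"
proof -
  have "a = 0 \<or> a = 1" for a :: boolean
    by (cases a) (auto simp: zero_boolean_def one_boolean_def)
  then show ?thesis
    by (auto simp: triangular01_monoid_def triangular_monoid_def)
qed

theorem theorem2p22:
  fixes n :: nat
  assumes additively_idempotent: "\<And>a :: 'a :: semiring_1. a + a = a"
    and "n \<ge> 2"
  shows "equationally_equivalent
           (triangular01_monoid n :: 'a mat monoid)
           (triangular_monoid n :: boolean mat monoid)"
  \<comment> \<open>Once the Boolean monoid is rewritten as \<open>triangular01_monoid n\<close>,
    both sides reduce to one criterion in terms of \<open>matches\<close>.\<close>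
  unfolding equationally_equivalent_def triangular01_boolean[symmetric]
  by (simp add: free_semigroup_def triangular01_satisfies_identity_iff[OF additively_idempotent]
      triangular01_satisfies_identity_iff[OF boolean_idem])

end
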